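(* Let $X$ be an unweighted graph on $n$ vertices and let $M\in\{L(X),Q(X)\}$. Let $\overline{d}=2|E(X)|/n$ be the average degree of $X$ and $\Delta$ its maximum degree. If local $\epsilon$-uniform mixing occurs at a vertex $u$ of $X$ relative to $M$, then $\deg u\le 2\overline{d}$. In particular, if $\epsilon$-uniform mixing occurs in $X$ relative to $M$, then $\Delta\le 2\overline{d}$.
   Context: Graphs are finite, simple, undirected and connected; unweighted means all edges have weight $1$. $A(X)$ is the adjacency matrix, $D(X)$ the diagonal matrix of vertex degrees, $L(X)=D(X)-A(X)$ the Laplacian and $Q(X)=D(X)+A(X)$ the signless Laplacian. For $M$, put $U(t)=e^{\mathrm{i}tM}$. $\mathbf{e}_u$ is the characteristic vector of $u$, $\mathbf{1}$ the all-ones vector, $\circ$ the entrywise product. Local $\epsilon$-uniform mixing occurs at $u$ relative to $M$ if for each $\epsilon>0$ there is a time $\tau\in\mathbb{R}$ such that $\big\|(U(\tau)\mathbf{e}_u)\circ(\overline{U(\tau)}\mathbf{e}_u)-\tfrac1n\mathbf{1}\big\|<\epsilon$. $\epsilon$-uniform mixing occurs in $X$ if for each $\epsilon>0$ there is a $\tau$ for which this inequality holds simultaneously for all vertices $u$. *)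

theory Defs
  imports "HOL-Analysis.Analysis"
begin

section \<open>Graphs and their matrices\<close>

text \<open>
  The vertex set is a type \<open>'v\<close> of class \<open>finite\<close> (hence nonempty), so that \<open>n = CARD('v)\<close>
  and matrices indexed by vertices have type \<^typ>\<open>real^'v^'v\<close>.  A graph on \<open>'v\<close> is given by
  its set of edges, each edge being an unordered pair of distinct vertices.
\<close>

definition simple_graph :: "'v::finite set set \<Rightarrow> bool" where
  "simple_graph E \<longleftrightarrow> (\<forall>e\<in>E. card e = 2)"

definition connected_graph :: "'v::finite set set \<Rightarrow> bool" where
  "connected_graph E \<longleftrightarrow> (\<forall>u v. (u, v) \<in> {(x, y). {x, y} \<in> E}\<^sup>*)"

definition vertex_degree :: "'v::finite set set \<Rightarrow> 'v \<Rightarrow> nat" where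
  "vertex_degree E u = card {v. {u, v} \<in> E}"

definition max_degree :: "'v::finite set set \<Rightarrow> nat" where
  "max_degree E = Max (range (vertex_degree E))"

definition average_degree :: "'v::finite set set \<Rightarrow> real" where
  "average_degree E = 2 * real (card E) / real CARD('v)"

definition adjacency_matrix :: "'v::finite set set \<Rightarrow> real^'v^'v" where
  "adjacency_matrix E = (\<chi> u v. if {u, v} \<in> E then 1 else 0)"

definition degree_matrix :: "'v::finite set set \<Rightarrow> real^'v^'v" where
  "degree_matrix E = (\<chi> u v. if u = v then real (vertex_degree E u) else 0)"

definition laplacian :: "'v::finite set set \<Rightarrow> real^'v^'v" where
  "laplacian E = degree_matrix E - adjacency_matrix E"

definition signless_laplacian :: "'v::finite set set \<Rightarrow> real^'v^'v" where
  "signless_laplacian E = degree_matrix E + adjacency_matrix E"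

section \<open>The matrix exponential\<close>

text \<open>
  Multiplication \<open>*\<close> on \<open>_^'v^'v\<close> is entrywise, so neither \<^term>\<open>exp\<close> nor \<open>^\<close> provides the
  matrix exponential and matrix powers; both are based on \<^term>\<open>(**)\<close> here.
\<close>

definition matrix_pow :: "complex^'v^'v \<Rightarrow> nat \<Rightarrow> complex^'v^'v::finite" where
  "matrix_pow A k = (((**) A) ^^ k) (mat 1)"

definition matrix_exp :: "complex^'v^'v \<Rightarrow> complex^'v^'v::finite" where
  "matrix_exp A = (\<Sum>k. (1 / fact k) *\<^sub>R matrix_pow A k)"

lemma norm_vec_le_sum:
  fixes x :: "'a::real_normed_vector^'n::finite"
  shows "norm x \<le> (\<Sum>i\<in>UNIV. norm (x $ i))"
  unfolding norm_vec_def by (rule L2_set_le_sum) simp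

lemma norm_matrix_pow_entry_le:
  fixes A :: "complex^'v^'v::finite"
  shows "norm (matrix_pow A k $ i $ j) \<le> (real CARD('v) * norm A) ^ k"
proof (induction k arbitrary: i)
  case 0
  then show ?case by (simp add: matrix_pow_def mat_def)
next
  case (Suc k)
  have entry: "norm (A $ i $ l) \<le> norm A" for l
    by (meson Finite_Cartesian_Product.norm_nth_le order_trans)
  have "norm (matrix_pow A (Suc k) $ i $ j)
      = norm (\<Sum>l\<in>UNIV. A $ i $ l * matrix_pow A k $ l $ j)"
    by (simp add: matrix_pow_def matrix_matrix_mult_def)
  also have "\<dots> \<le> (\<Sum>l\<in>(UNIV::'v set). norm A * (real CARD('v) * norm A) ^ k)"
    by (rule sum_norm_le) (simp add: norm_mult mult_mono entry Suc.IH)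
  finally show ?case by (simp add: mult_ac)
qed

text \<open>The defining series always converges.\<close>

lemma summable_matrix_exp:
  fixes A :: "complex^'v^'v::finite"
  shows "summable (\<lambda>k. (1 / fact k) *\<^sub>R matrix_pow A k)"
proof -
  define c where "c = real CARD('v) * norm A"
  define m where "m = real CARD('v)"
  have bound: "norm (matrix_pow A k) \<le> m * (m * c ^ k)" for k
  proof -
    have "norm (matrix_pow A k) \<le> (\<Sum>i\<in>UNIV. \<Sum>j\<in>UNIV. norm (matrix_pow A k $ i $ j))"
      by (rule order_trans[OF norm_vec_le_sum sum_mono]) (rule norm_vec_le_sum)
    also have "\<dots> \<le> (\<Sum>i\<in>(UNIV::'v set). \<Sum>j\<in>(UNIV::'v set). c ^ k)"
      unfolding c_def by (intro sum_mono norm_matrix_pow_entry_le)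
    finally show ?thesis by (simp add: m_def)
  qed
  have "summable (\<lambda>k. m * m * (inverse (fact k) * c ^ k))"
    by (intro summable_mult summable_exp)
  then show ?thesis
  proof (rule summable_comparison_test'[where N = 0])
    fix k
    have "norm ((1 / fact k) *\<^sub>R matrix_pow A k) = inverse (fact k) * norm (matrix_pow A k)"
      by (simp add: divide_inverse)
    also have "\<dots> \<le> inverse (fact k) * (m * (m * c ^ k))"
      by (intro mult_left_mono bound) simp
    finally show "norm ((1 / fact k) *\<^sub>R matrix_pow A k) \<le> m * m * (inverse (fact k) * c ^ k)"
      by (simp add: mult_ac)
  qed
qed

section \<open>Uniform mixing\<close>

definition transition_matrix :: "real^'v^'v \<Rightarrow> real \<Rightarrow> complex^'v^'v::finite" where
  "transition_matrix M t = matrix_exp (\<chi> u v. \<i> * of_real t * of_real (M $ u $ v))"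

definition cnj_matrix :: "complex^'v^'v \<Rightarrow> complex^'v^'v::finite" where
  "cnj_matrix A = (\<chi> u v. cnj (A $ u $ v))"

text \<open>
  On \<^typ>\<open>complex^'v\<close>, the library's \<open>*\<close> is the entrywise product, \<open>1\<close> is the all-ones vector
  and \<^term>\<open>norm\<close> is the Euclidean norm; \<^term>\<open>axis u 1\<close> is the characteristic vector of \<open>u\<close>.
\<close>

definition mixing_defect :: "real^'v^'v \<Rightarrow> real \<Rightarrow> 'v::finite \<Rightarrow> real" where
  "mixing_defect M t u =
    norm ((transition_matrix M t *v axis u 1) * (cnj_matrix (transition_matrix M t) *v axis u 1)
          - (1 / real CARD('v)) *\<^sub>R (1 :: complex^'v))"

definition local_eps_uniform_mixing :: "real^'v^'v \<Rightarrow> 'v::finite \<Rightarrow> bool" where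
  "local_eps_uniform_mixing M u \<longleftrightarrow> (\<forall>\<epsilon>>0. \<exists>\<tau>. mixing_defect M \<tau> u < \<epsilon>)"

definition eps_uniform_mixing :: "real^'v^'v::finite \<Rightarrow> bool" where
  "eps_uniform_mixing M \<longleftrightarrow> (\<forall>\<epsilon>>0. \<exists>\<tau>. \<forall>u. mixing_defect M \<tau> u < \<epsilon>)"

end

(* Put \<psi> = U(\<tau>) e_u. Since U(\<tau>) is unitary and commutes with M, the energy
   \<psi>\<^sup>* M \<psi> equals its initial value M_uu = deg u. On the other hand,
   2 |\<psi>_v \<psi>_w| \<le> |\<psi>_v|^2 + |\<psi>_w|^2 on each edge gives \<psi>\<^sup>* M \<psi> \<le> 2 \<Sum>_v deg v |\<psi>_v|^2.
   As |\<psi>_v|^2 can be made arbitrarily close to 1/n, the right-hand side approaches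
   2 (\<Sum>_v deg v) / n, which is twice the average degree. *)

theory Submission
  imports Defs
begin

section \<open>Matrix powers and the matrix exponential, entry by entry\<close>

lemma matrix_pow_0_nth: "matrix_pow A 0 $ i $ j = (if i = j then 1 else 0)"
  by (simp add: matrix_pow_def mat_def)

lemma matrix_pow_Suc_nth:
  "matrix_pow A (Suc k) $ i $ j = (\<Sum>l\<in>UNIV. A $ i $ l * matrix_pow A k $ l $ j)"
  by (simp add: matrix_pow_def matrix_matrix_mult_def)

lemma matrix_pow_scale_nth:
  "matrix_pow (\<chi> i j. z * A $ i $ j) k $ i $ j = z ^ k * matrix_pow A k $ i $ j"
  by (induction k arbitrary: i)
    (simp_all add: matrix_pow_0_nth matrix_pow_Suc_nth sum_distrib_left mult_ac)

lemma cnj_matrix_pow_nth: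
  "cnj (matrix_pow A k $ i $ j) = matrix_pow (cnj_matrix A) k $ i $ j"
  by (induction k arbitrary: i)
    (simp_all add: matrix_pow_0_nth matrix_pow_Suc_nth cnj_matrix_def)

text \<open>Taking an entry is bounded linear, so it commutes with the defining series. This reduces
  the exponential to scalar series.\<close>

lemma matrix_exp_nth_sums:
  "(\<lambda>k. matrix_pow A k $ i $ j / fact k) sums (matrix_exp A $ i $ j)"
proof -
  have "(\<lambda>k. (1 / fact k) *\<^sub>R matrix_pow A k) sums matrix_exp A"
    unfolding matrix_exp_def by (rule summable_sums[OF summable_matrix_exp])
  from bounded_linear.sums[OF bounded_linear_vec_nth
      bounded_linear.sums[OF bounded_linear_vec_nth this]]
  have "(\<lambda>k. ((1 / fact k) *\<^sub>R matrix_pow A k) $ i $ j) sums (matrix_exp A $ i $ j)" .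
  then show ?thesis
    by (simp only: vector_scaleR_component) (simp add: scaleR_conv_of_real)
qed

lemma cnj_matrix_exp_nth:
  "cnj (matrix_exp A $ i $ j) = matrix_exp (cnj_matrix A) $ i $ j"
proof -
  have "(\<lambda>k. cnj (matrix_pow A k $ i $ j / fact k)) sums cnj (matrix_exp A $ i $ j)"
    using matrix_exp_nth_sums by (simp only: sums_cnj)
  then have "(\<lambda>k. matrix_pow (cnj_matrix A) k $ i $ j / fact k) sums cnj (matrix_exp A $ i $ j)"
    by (simp add: cnj_matrix_pow_nth)
  then show ?thesis
    using matrix_exp_nth_sums sums_unique2 by blast
qed

text \<open>For fixed \<open>A\<close>, each entry of exp(zA) is thus an everywhere convergent power
  series in \<open>z\<close>, which permits termwise differentiation.\<close>

lemma matrix_exp_scale_nth_sums: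
  "(\<lambda>k. matrix_pow A k $ i $ j / fact k * z ^ k) sums matrix_exp (\<chi> i j. z * A $ i $ j) $ i $ j"
  using matrix_exp_nth_sums[of "\<chi> i j. z * A $ i $ j" i j]
  by (simp only: matrix_pow_scale_nth times_divide_eq_left mult.commute[of "z ^ _"])

lemma matrix_exp_scale_0_nth:
  "matrix_exp (\<chi> i j. 0 * A $ i $ j) $ i $ j = (if i = j then 1 else 0)"
proof -
  have "(\<lambda>k. matrix_pow A k $ i $ j / fact k * 0 ^ k) sums (matrix_pow A 0 $ i $ j / fact 0)"
    by (rule powser_sums_zero)
  moreover have "(\<lambda>k. matrix_pow A k $ i $ j / fact k * 0 ^ k)
      sums matrix_exp (\<chi> i j. 0 * A $ i $ j) $ i $ j"
    by (rule matrix_exp_scale_nth_sums)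
  ultimately show ?thesis
    using sums_unique2 by (fastforce simp: matrix_pow_0_nth)
qed

text \<open>Differentiating shifts the coefficients and cancels \<open>Suc k\<close> against the
  factorial; splitting one factor \<open>A\<close> off the power then gives d/dz exp(zA) = A
  exp(zA).\<close>

lemma matrix_exp_scale_nth_has_field_derivative:
  fixes A :: "complex^'v^'v::finite"
  shows "((\<lambda>z. matrix_exp (\<chi> i j. z * A $ i $ j) $ i $ j) has_field_derivative
     (\<Sum>l\<in>UNIV. A $ i $ l * matrix_exp (\<chi> i j. z * A $ i $ j) $ l $ j)) (at z)"
proof -
  define c where "c i k = matrix_pow A k $ i $ j / fact k" for i k
  have sums: "(\<lambda>k. c i k * z ^ k) sums matrix_exp (\<chi> i j. z * A $ i $ j) $ i $ j" for i z
    unfolding c_def by (rule matrix_exp_scale_nth_sums)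
  have "((\<lambda>z. \<Sum>k. c i k * z ^ k) has_field_derivative (\<Sum>k. diffs (c i) k * z ^ k)) (at z)"
    using sums sums_summable by (intro termdiffs_strong_converges_everywhere) blast
  moreover have "(\<lambda>z. \<Sum>k. c i k * z ^ k) = (\<lambda>z. matrix_exp (\<chi> i j. z * A $ i $ j) $ i $ j)"
    using sums_unique[OF sums] by presburger
  moreover have "(\<lambda>k. \<Sum>l\<in>UNIV. A $ i $ l * (c l k * z ^ k))
      sums (\<Sum>l\<in>UNIV. A $ i $ l * matrix_exp (\<chi> i j. z * A $ i $ j) $ l $ j)"
    by (intro sums_sum sums_mult sums)
  moreover have "diffs (c i) k * z ^ k = (\<Sum>l\<in>UNIV. A $ i $ l * (c l k * z ^ k))" for k
  proof -
    have "diffs (c i) k = matrix_pow A (Suc k) $ i $ j / fact k"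
      unfolding diffs_def c_def by (simp add: field_simps del: of_nat_Suc)
    then show ?thesis
      by (simp add: c_def matrix_pow_Suc_nth sum_distrib_right sum_divide_distrib mult.assoc)
  qed
  ultimately show ?thesis
    by (simp add: sums_iff)
qed

text \<open>
  For real \<open>A\<close> and imaginary \<open>z\<close>, the factor \<open>p i (- z)\<close> is the conjugate of \<open>p i z\<close>;
  writing it this way keeps the quadratic form holomorphic in \<open>z\<close>.
\<close>

lemma quadratic_form_matrix_exp_column:
  fixes A :: "complex^'v^'v::finite" and u :: 'v
  assumes sym: "\<And>i j. A $ i $ j = A $ j $ i"
  defines "p \<equiv> \<lambda>i z. matrix_exp (\<chi> i j. z * A $ i $ j) $ i $ u"
  shows "(\<Sum>i\<in>UNIV. p i (- z) * (\<Sum>j\<in>UNIV. A $ i $ j * p j z)) = A $ u $ u"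
proof -
  \<comment> \<open>\<open>r\<close> is \<open>A\<close> applied to the column \<open>p\<close>: at
    once the derivative of \<open>p\<close> and the second factor of the quadratic form.\<close>
  define r where "r i z = (\<Sum>j\<in>UNIV. A $ i $ j * p j z)" for i z
  have p': "(p i has_field_derivative r i z) (at z)" for i z
    unfolding p_def r_def by (rule matrix_exp_scale_nth_has_field_derivative)
  have p_neg': "((\<lambda>z. p i (- z)) has_field_derivative - r i (- z)) (at z)" for i z
    using DERIV_chain2[OF p' DERIV_minus[OF DERIV_ident]] by simp
  have r': "(r i has_field_derivative (\<Sum>j\<in>UNIV. A $ i $ j * r j z)) (at z)" for i z
  proof -
    have "((\<lambda>z. \<Sum>j\<in>UNIV. A $ i $ j * p j z) has_field_derivative
        (\<Sum>j\<in>UNIV. A $ i $ j * r j z)) (at z)"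
      by (intro DERIV_sum DERIV_cmult p')
    then show ?thesis
      by (simp only: r_def[abs_def])
  qed
  have "((\<lambda>z. \<Sum>i\<in>UNIV. p i (- z) * r i z) has_field_derivative 0) (at z)" for z
  proof -
    have "((\<lambda>z. \<Sum>i\<in>UNIV. p i (- z) * r i z) has_field_derivative
        (\<Sum>i\<in>UNIV. - r i (- z) * r i z + (\<Sum>j\<in>UNIV. A $ i $ j * r j z) * p i (- z))) (at z)"
      by (intro DERIV_sum DERIV_mult p_neg' r')
    \<comment> \<open>Symmetry moves \<open>A\<close> from \<open>r j z\<close> onto
      \<open>p i (- z)\<close>, so the two terms of the product rule cancel.\<close>
    moreover have "(\<Sum>i\<in>UNIV. (\<Sum>j\<in>UNIV. A $ i $ j * r j z) * p i (- z))
        = (\<Sum>i\<in>UNIV. r i (- z) * r i z)"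
      unfolding sum_distrib_right r_def[of _ "- z"]
      by (subst sum.swap) (intro sum.cong refl, simp add: sym mult_ac)
    ultimately show ?thesis
      by (simp add: sum_subtractf)
  qed
  then have "\<exists>c. \<forall>z\<in>UNIV. (\<Sum>i\<in>UNIV. p i (- z) * r i z) = c"
    by (intro has_field_derivative_zero_constant convex_UNIV) simp
  then obtain c where c: "(\<Sum>i\<in>UNIV. p i (- z) * r i z) = c" for z
    by blast
  \<comment> \<open>At \<open>z = 0\<close> the column is the characteristic vector of
    \<open>u\<close>, which identifies the constant.\<close>
  have p0: "p i 0 = (if i = u then 1 else 0)" for i
    using matrix_exp_scale_0_nth[of A i u] by (simp only: p_def)
  have "c = A $ u $ u"
    using c[of 0] by (simp add: r_def p0 if_distrib if_distribR sum.delta cong: if_cong)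
  with c show ?thesis
    by (simp add: r_def)
qed

text \<open>Conservation of energy. As \<open>M\<close> is real, conjugating exp(itM) negates the
  exponent, so the preceding identity applies at z = it.\<close>

lemma transition_matrix_energy:
  fixes M :: "real^'v^'v::finite" and u :: 'v
  assumes sym: "\<And>i j. M $ i $ j = M $ j $ i"
  defines "\<psi> \<equiv> \<lambda>t i. transition_matrix M t $ i $ u"
  shows "(\<Sum>i\<in>UNIV. \<Sum>j\<in>UNIV. of_real (M $ i $ j) * (cnj (\<psi> t i) * \<psi> t j)) = of_real (M $ u $ u)"
proof -
  define A :: "complex^'v^'v" where "A = (\<chi> i j. of_real (M $ i $ j))"
  have \<psi>: "\<psi> t i = matrix_exp (\<chi> i j. (\<i> * of_real t) * A $ i $ j) $ i $ u" for i
    by (simp add: \<psi>_def transition_matrix_def A_def)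
  have cnj_\<psi>: "cnj (\<psi> t i) = matrix_exp (\<chi> i j. - (\<i> * of_real t) * A $ i $ j) $ i $ u" for i
    by (simp add: \<psi>_def transition_matrix_def cnj_matrix_exp_nth cnj_matrix_def A_def)
  have "(\<Sum>i\<in>UNIV. cnj (\<psi> t i) * (\<Sum>j\<in>UNIV. A $ i $ j * \<psi> t j)) = A $ u $ u"
    \<comment> \<open>The conjugates are rewritten first, since unfolding \<psi> would destroy the
      left-hand side of \<open>cnj_\<psi>\<close>.\<close>
    unfolding cnj_\<psi> unfolding \<psi>
    by (rule quadratic_form_matrix_exp_column) (simp add: A_def sym)
  then show ?thesis
    by (simp add: A_def sum_distrib_left mult_ac)
qed

section \<open>Degree sums and the bound on the quadratic form\<close>

text \<open>Double counting of incidences: neighbours of \<open>v\<close> correspond to edges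
  through \<open>v\<close>, and each edge has two ends.\<close>

lemma sum_vertex_degree:
  fixes E :: "'v::finite set set"
  assumes "simple_graph E"
  shows "(\<Sum>v\<in>UNIV. vertex_degree E v) = 2 * card E"
proof -
  have two: "card e = 2" if "e \<in> E" for e
    using assms that by (simp add: simple_graph_def)
  have "vertex_degree E v = card {e \<in> E. v \<in> e}" for v
  proof -
    have "inj_on (\<lambda>w. {v, w}) {w. {v, w} \<in> E}"
      by (auto simp: inj_on_def doubleton_eq_iff)
    moreover have "(\<lambda>w. {v, w}) ` {w. {v, w} \<in> E} = {e \<in> E. v \<in> e}"
    proof (intro equalityI subsetI)
      fix e assume e: "e \<in> {e \<in> E. v \<in> e}"
      then have "card e = 2"
        using two by blast
      then obtain x y where "e = {x, y}"
        by (meson card_2_iff)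
      with e have "e = {v, x} \<or> e = {v, y}"
        by (simp only: mem_Collect_eq insert_iff empty_iff doubleton_eq_iff) blast
      with e show "e \<in> (\<lambda>w. {v, w}) ` {w. {v, w} \<in> E}"
        by auto
    qed auto
    ultimately show ?thesis
      using card_image[of "\<lambda>w. {v, w}" "{w. {v, w} \<in> E}"]
      by (simp only: vertex_degree_def)
  qed
  then have "(\<Sum>v\<in>UNIV. vertex_degree E v) = (\<Sum>v\<in>UNIV. card {e \<in> E. v \<in> e})"
    by simp
  also have "\<dots> = 2 * card E"
    by (rule sum_multicount) (simp_all add: two)
  finally show ?thesis .
qed

lemma vertex_degree_conv_sum:
  "real (vertex_degree E v) = (\<Sum>w\<in>UNIV. if {v, w} \<in> E then 1 else 0)"
  by (simp add: vertex_degree_def sum.If_cases)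

text \<open>Each off-diagonal term is split evenly between its two ends by the inequality of
  arithmetic and geometric means. The diagonal and the adjacency part then each contribute at most
  the degree sum, hence the factor 2.\<close>

lemma quadratic_form_le_degree_sum:
  fixes E :: "'v::finite set set" and \<psi> :: "'v \<Rightarrow> complex"
  assumes M: "M \<in> {laplacian E, signless_laplacian E}"
  shows "Re (\<Sum>i\<in>UNIV. \<Sum>j\<in>UNIV. of_real (M $ i $ j) * (cnj (\<psi> i) * \<psi> j))
    \<le> 2 * (\<Sum>i\<in>UNIV. real (vertex_degree E i) * (cmod (\<psi> i))\<^sup>2)"
proof -
  define a :: "'v \<Rightarrow> 'v \<Rightarrow> real" where "a i j = (if {i, j} \<in> E then 1 else 0)" for i j
  have a_sym: "a i j = a j i" for i j
    by (simp add: a_def insert_commute)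
  define S where "S = (\<Sum>i\<in>UNIV. real (vertex_degree E i) * (cmod (\<psi> i))\<^sup>2)"
  have deg: "real (vertex_degree E i) = (\<Sum>j\<in>UNIV. a i j)" for i
    unfolding a_def by (rule vertex_degree_conv_sum)
  have S1: "(\<Sum>i\<in>UNIV. \<Sum>j\<in>UNIV. a i j * (cmod (\<psi> i))\<^sup>2) = S"
    by (simp add: S_def deg sum_distrib_right)
  have S2: "(\<Sum>i\<in>UNIV. \<Sum>j\<in>UNIV. a i j * (cmod (\<psi> j))\<^sup>2) = S"
    unfolding S1[symmetric] by (subst sum.swap) (simp add: a_sym)
  have entry: "M $ i $ j * Re (cnj (\<psi> i) * \<psi> j)
      \<le> (if i = j then real (vertex_degree E i) * (cmod (\<psi> i))\<^sup>2 else 0)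
        + (a i j * (cmod (\<psi> i))\<^sup>2 + a i j * (cmod (\<psi> j))\<^sup>2) / 2" for i j
  proof -
    have "\<bar>Re (cnj (\<psi> i) * \<psi> j)\<bar> \<le> cmod (\<psi> i) * cmod (\<psi> j)"
      using abs_Re_le_cmod[of "cnj (\<psi> i) * \<psi> j"] by (simp add: norm_mult)
    also have "\<dots> \<le> ((cmod (\<psi> i))\<^sup>2 + (cmod (\<psi> j))\<^sup>2) / 2"
      using sum_squares_bound[of "cmod (\<psi> i)" "cmod (\<psi> j)"] by simp
    finally have "\<bar>Re (cnj (\<psi> i) * \<psi> j)\<bar> \<le> ((cmod (\<psi> i))\<^sup>2 + (cmod (\<psi> j))\<^sup>2) / 2" .
    \<comment> \<open>Without the degree term, the two matrices differ only in sign, so the absolute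
      value treats both at once.\<close>
    moreover have "\<bar>M $ i $ j - (if i = j then real (vertex_degree E i) else 0)\<bar> = a i j"
      using M by (auto simp: laplacian_def signless_laplacian_def degree_matrix_def
          adjacency_matrix_def a_def)
    ultimately have "\<bar>(M $ i $ j - (if i = j then real (vertex_degree E i) else 0))
        * Re (cnj (\<psi> i) * \<psi> j)\<bar> \<le> a i j * (((cmod (\<psi> i))\<^sup>2 + (cmod (\<psi> j))\<^sup>2) / 2)"
      by (simp add: abs_mult a_def)
    moreover have "(if i = j then real (vertex_degree E i) else 0) * Re (cnj (\<psi> i) * \<psi> j)
        = (if i = j then real (vertex_degree E i) * (cmod (\<psi> i))\<^sup>2 else 0)"
      by (simp only: cmod_power2) (simp add: power2_eq_square)
    ultimately show ?thesis
      by (simp only: abs_le_iff left_diff_distrib distrib_left add_divide_distrib times_divide_eq_right)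
        linarith
  qed
  have "Re (\<Sum>i\<in>UNIV. \<Sum>j\<in>UNIV. of_real (M $ i $ j) * (cnj (\<psi> i) * \<psi> j))
      = (\<Sum>i\<in>UNIV. \<Sum>j\<in>UNIV. M $ i $ j * Re (cnj (\<psi> i) * \<psi> j))"
    by (simp only: Re_sum Re_complex_of_real Im_complex_of_real times_complex.sel mult_zero_left diff_zero)
  also have "\<dots> \<le> (\<Sum>i\<in>UNIV. \<Sum>j\<in>UNIV.
        (if i = j then real (vertex_degree E i) * (cmod (\<psi> i))\<^sup>2 else 0)
        + (a i j * (cmod (\<psi> i))\<^sup>2 + a i j * (cmod (\<psi> j))\<^sup>2) / 2)"
    by (intro sum_mono entry)
  also have "\<dots> = S + (S + S) / 2"
    by (simp add: sum.distrib add_divide_distrib S1 S2 S_def[symmetric]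
        flip: sum_divide_distrib)
  finally show ?thesis
    by (simp add: S_def)
qed

section \<open>From mixing to the degree bound\<close>

text \<open>A coordinate of the defect vector is bounded by its Euclidean norm; only the upper
  estimate is kept.\<close>

lemma transition_matrix_entry_le:
  fixes M :: "real^'v^'v::finite"
  shows "(cmod (transition_matrix M t $ v $ u))\<^sup>2 \<le> 1 / real CARD('v) + mixing_defect M t u"
proof -
  let ?z = "transition_matrix M t $ v $ u"
  have column: "(B *v axis u 1) $ v = B $ v $ u" for B :: "complex^'v^'v"
    by (simp add: matrix_vector_mult_def axis_def if_distrib cong: if_cong)
  have "((transition_matrix M t *v axis u 1) * (cnj_matrix (transition_matrix M t) *v axis u 1)
      - (1 / real CARD('v)) *\<^sub>R 1) $ v = ?z * cnj ?z - (1 / real CARD('v)) *\<^sub>R 1"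
    by (simp only: vector_minus_component vector_scaleR_component vector_mult_component
        one_index column) (simp add: cnj_matrix_def)
  then have "cmod (?z * cnj ?z - of_real (1 / real CARD('v))) \<le> mixing_defect M t u"
    unfolding mixing_defect_def scaleR_conv_of_real[of _ "1::complex"] mult_1_right
    by (metis Finite_Cartesian_Product.norm_nth_le)
  then have "cmod (of_real ((cmod ?z)\<^sup>2 - 1 / real CARD('v))) \<le> mixing_defect M t u"
    by (simp only: complex_norm_square of_real_diff)
  then show ?thesis
    unfolding norm_of_real by linarith
qed

lemma vertex_degree_le_if_local_eps_uniform_mixing:
  fixes E :: "'v::finite set set" and M :: "real^'v^'v"
  assumes E: "simple_graph E"
    and M: "M \<in> {laplacian E, signless_laplacian E}"
    and mixing: "local_eps_uniform_mixing M u"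
  shows "real (vertex_degree E u) \<le> 2 * average_degree E"
proof -
  define m where "m = real (card E)"
  have sym: "M $ i $ j = M $ j $ i" for i j
    using M by (auto simp: laplacian_def signless_laplacian_def degree_matrix_def
        adjacency_matrix_def insert_commute)
  \<comment> \<open>A loop would be an edge of cardinality 1. Its absence leaves only the degree on
    the diagonal.\<close>
  have no_loop: "{u, u} \<notin> E"
    using E by (auto simp: simple_graph_def)
  have diag: "M $ u $ u = real (vertex_degree E u)"
    using M no_loop by (auto simp: laplacian_def signless_laplacian_def degree_matrix_def
        adjacency_matrix_def)
  have handshake: "(\<Sum>v\<in>UNIV. real (vertex_degree E v)) = 2 * m"
    using sum_vertex_degree[OF E] unfolding m_def by (metis of_nat_sum of_nat_mult of_nat_numeral)
  \<comment> \<open>The error \<open>4 * m * \<epsilon>\<close> is the factor 2 of the form bound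
    times the degree sum \<open>2 * m\<close> times \<epsilon>.\<close>
  have bound: "real (vertex_degree E u) \<le> 2 * average_degree E + 4 * m * \<epsilon>" if \<epsilon>: "\<epsilon> > 0" for \<epsilon>
  proof -
    obtain t where t: "mixing_defect M t u < \<epsilon>"
      using mixing \<epsilon> unfolding local_eps_uniform_mixing_def by blast
    have "real (vertex_degree E u)
        \<le> 2 * (\<Sum>v\<in>UNIV. real (vertex_degree E v) * (cmod (transition_matrix M t $ v $ u))\<^sup>2)"
      using quadratic_form_le_degree_sum[OF M, of "\<lambda>v. transition_matrix M t $ v $ u"]
      unfolding transition_matrix_energy[OF sym] by (simp add: diag)
    also have "\<dots> \<le> 2 * (\<Sum>v\<in>UNIV. real (vertex_degree E v) * (1 / real CARD('v) + \<epsilon>))"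
      using t by (intro mult_left_mono sum_mono order_trans[OF transition_matrix_entry_le]) auto
    also have "\<dots> = 2 * average_degree E + 4 * m * \<epsilon>"
      unfolding sum_distrib_right[symmetric] handshake
      by (simp add: average_degree_def m_def algebra_simps)
    finally show ?thesis .
  qed
  show ?thesis
  proof (rule field_le_epsilon)
    fix e :: real assume e: "e > 0"
    \<comment> \<open>This is the \<epsilon> fed to \<open>bound\<close>; the summand 1 keeps the
      denominator positive when there are no edges.\<close>
    have "4 * m * (e / (4 * m + 1)) \<le> e"
      using e by (simp add: m_def field_simps)
    moreover have "e / (4 * m + 1) > 0"
      using e by (simp add: m_def add_nonneg_pos)
    ultimately show "real (vertex_degree E u) \<le> 2 * average_degree E + e"
      using bound by (meson add_left_mono order_trans)
  qed
qed

theorem theorem1: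
  fixes E :: "'v::finite set set" and M :: "real^'v^'v"
  assumes "simple_graph E" and "connected_graph E"
    and "M \<in> {laplacian E, signless_laplacian E}"
  shows "(\<forall>u. local_eps_uniform_mixing M u \<longrightarrow> real (vertex_degree E u) \<le> 2 * average_degree E)
    \<and> (eps_uniform_mixing M \<longrightarrow> real (max_degree E) \<le> 2 * average_degree E)"
proof (intro conjI allI impI)
  show "real (vertex_degree E u) \<le> 2 * average_degree E" if "local_eps_uniform_mixing M u" for u
    by (rule vertex_degree_le_if_local_eps_uniform_mixing[OF assms(1,3) that])
next
  assume "eps_uniform_mixing M"
  then have "local_eps_uniform_mixing M u" for u
    unfolding eps_uniform_mixing_def local_eps_uniform_mixing_def by blast
  then have "real (vertex_degree E u) \<le> 2 * average_degree E" for u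
    by (rule vertex_degree_le_if_local_eps_uniform_mixing[OF assms(1,3)])
  \<comment> \<open>The maximum is attained at some vertex, where the local bound applies.\<close>
  moreover have "max_degree E \<in> range (vertex_degree E)"
    unfolding max_degree_def by (rule Max_in) auto
  ultimately show "real (max_degree E) \<le> 2 * average_degree E"
    by auto
qed

end
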